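(* Let $n\ge 1$ and let $A_n^{-1}=(b_{ij})_{1\le i,j\le n}$ be the inverse of the $n$-th order permutation generation matrix $A_n$. Then for all $1\le i,j\le n$: (i) if $i+j>n+1$, then $b_{ij}=0$; (ii) if $i+j=n+1$, then $b_{ij}=1$; (iii) if $i+j\le n$ and $i\ne 1$, then $b_{ij}=-i\,b_{i,\,j+1}+b_{i-1,\,j+1}$; (iv) if $i=1$, then $b_{1j}=(-1)^{j+n}$.
   Context: For an integer $k\ge 1$ and a natural number $m$, $P_k(m) = m(m+1)\cdots(m+k-1)$. The $n$-th order permutation generation matrix $A_n$ is the $n\times n$ matrix with constant (independent of $m$) real entries such that, for all natural numbers $m$, $$(P_1(m), P_2(m), \ldots, P_n(m)) = (m^n, m^{n-1}, \ldots, m)\,A_n .$$ (Such a matrix exists, is unique, and is invertible.) *)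

theory Defs
  imports "Jordan_Normal_Form.Determinant" "HOL-Combinatorics.Stirling"
begin

(* The library's pochhammer x k is x (x + 1) \<dots> (x + k - 1), so P_k(m) is pochhammer (real m) k.
   Vectors and matrices are indexed from 0: the (i, j) entry, counted from 1, is at (i - 1, j - 1). *)

definition power_row :: "nat \<Rightarrow> nat \<Rightarrow> real vec" where
  "power_row n m = vec n (\<lambda>i. real m ^ (n - i))"

definition rising_row :: "nat \<Rightarrow> nat \<Rightarrow> real vec" where
  "rising_row n m = vec n (\<lambda>j. pochhammer (real m) (j + 1))"

definition is_perm_gen_mat :: "nat \<Rightarrow> real mat \<Rightarrow> bool" where
  "is_perm_gen_mat n A \<longleftrightarrow> A \<in> carrier_mat n n \<and>
     (\<forall>m. mat_of_row (rising_row n m) = mat_of_row (power_row n m) * A)"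

(* Well defined: see perm_gen_mat_ex1 below. *)
definition perm_gen_mat :: "nat \<Rightarrow> real mat" where
  "perm_gen_mat n = (THE A. is_perm_gen_mat n A)"

definition entry1 :: "'a mat \<Rightarrow> nat \<Rightarrow> nat \<Rightarrow> 'a" where
  "entry1 B i j = B $$ (i - 1, j - 1)"


lemma mat_of_row_mult_eq_iff:
  assumes "v \<in> carrier_vec n" "A \<in> carrier_mat n n" "w \<in> carrier_vec n"
  shows "mat_of_row w = mat_of_row v * A \<longleftrightarrow> (\<forall>j<n. w $ j = (\<Sum>i<n. v $ i * A $$ (i, j)))"
  using assms by (auto simp: mat_eq_iff scalar_prod_def lessThan_atLeast0)

lemma power_row_sum_eq_imp:
  assumes "\<And>m. (\<Sum>i<n. real m ^ (n - i) * c i) = (\<Sum>i<n. real m ^ (n - i) * d i)"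
  shows "\<forall>i<n. c i = d i"
proof -
  define p where "p = (\<Sum>i<n. monom (c i - d i) (n - i))"
  have "poly p (real m) = 0" for m
    using assms[of m]
    by (simp add: p_def poly_sum poly_monom algebra_simps sum_subtractf)
  then have "range real \<subseteq> {x. poly p x = 0}" by auto
  moreover have "infinite (range real)"
    by (simp add: finite_image_iff)
  ultimately have "p = 0"
    using poly_roots_finite finite_subset by blast
  show ?thesis
  proof (intro allI impI)
    fix i assume i: "i < n"
    have "coeff p (n - i) = (\<Sum>k<n. if k = i then c k - d k else 0)"
      unfolding p_def coeff_sum using i by (intro sum.cong) auto
    also have "\<dots> = c i - d i" using i by simp
    finally show "c i = d i" using \<open>p = 0\<close> by simp
  qed
qed

lemma is_perm_gen_mat_iff:
  "is_perm_gen_mat n A \<longleftrightarrow> A \<in> carrier_mat n n \<and>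
     (\<forall>m. \<forall>j<n. pochhammer (real m) (j + 1) = (\<Sum>i<n. real m ^ (n - i) * A $$ (i, j)))"
proof (cases "A \<in> carrier_mat n n")
  case True
  have "mat_of_row (rising_row n m) = mat_of_row (power_row n m) * A \<longleftrightarrow>
     (\<forall>j<n. pochhammer (real m) (j + 1) = (\<Sum>i<n. real m ^ (n - i) * A $$ (i, j)))" for m
    by (subst mat_of_row_mult_eq_iff[OF _ True])
       (auto simp: rising_row_def power_row_def)
  with True show ?thesis by (simp add: is_perm_gen_mat_def)
qed (simp add: is_perm_gen_mat_def)

lemma perm_gen_mat_exists:
  "is_perm_gen_mat n (mat n n (\<lambda>(i, j). real (stirling (j + 1) (n - i))))"
  unfolding is_perm_gen_mat_iff
proof (intro conjI allI impI)
  fix m j assume j: "j < n"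
  have "pochhammer (real m) (j + 1) = (\<Sum>k\<le>j + 1. real (stirling (j + 1) k) * real m ^ k)"
    by (simp only: stirling_pochhammer)
  also have "\<dots> = (\<Sum>k\<le>n. real (stirling (j + 1) k) * real m ^ k)"
    using j by (intro sum.mono_neutral_left) auto
  also have "\<dots> = (\<Sum>k\<in>{1..n}. real (stirling (j + 1) k) * real m ^ k)"
    by (intro sum.mono_neutral_right) (auto simp: not_le)
  also have "\<dots> = (\<Sum>i<n. real m ^ (n - i) * real (stirling (j + 1) (n - i)))"
    by (rule sum.reindex_bij_witness[of _ "\<lambda>i. n - i" "\<lambda>k. n - k"]) auto
  finally show "pochhammer (real m) (j + 1) = (\<Sum>i<n. real m ^ (n - i) *
      mat n n (\<lambda>(i, j). real (stirling (j + 1) (n - i))) $$ (i, j))"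
    using j by simp
qed auto

lemma perm_gen_mat_ex1: "\<exists>!A. is_perm_gen_mat n A"
proof (rule ex_ex1I)
  fix A B assume A: "is_perm_gen_mat n A" and B: "is_perm_gen_mat n B"
  have "\<forall>i<n. A $$ (i, j) = B $$ (i, j)" if "j < n" for j
    by (rule power_row_sum_eq_imp) (use A B that in \<open>auto simp: is_perm_gen_mat_iff\<close>)
  then show "A = B" using A B by (auto simp: is_perm_gen_mat_def)
qed (use perm_gen_mat_exists in blast)

lemma is_perm_gen_mat_perm_gen_mat: "is_perm_gen_mat n (perm_gen_mat n)"
  unfolding perm_gen_mat_def using perm_gen_mat_ex1 by (rule theI')

lemma power_eq_pochhammer_sum:
  "\<exists>c. \<forall>m. real m ^ Suc k = (\<Sum>j\<le>k. pochhammer (real m) (j + 1) * c j)"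
proof (induction k)
  case 0
  show ?case by (intro exI[of _ "\<lambda>_. 1"]) simp
next
  case (Suc k)
  then obtain c where c: "\<And>m. real m ^ Suc k = (\<Sum>j\<le>k. pochhammer (real m) (j + 1) * c j)"
    by blast
  define d where "d j = (if j = 0 then 0 else c (j - 1)) - (if j \<le> k then real (j + 1) * c j else 0)"
    for j
  have "real m ^ Suc (Suc k) = (\<Sum>j\<le>Suc k. pochhammer (real m) (j + 1) * d j)" for m
  proof -
    have "real m ^ Suc (Suc k) = (\<Sum>j\<le>k. real m * (pochhammer (real m) (j + 1) * c j))"
      by (subst power_Suc, subst c) (simp only: sum_distrib_left)
    also have "\<dots> = (\<Sum>j\<le>k. pochhammer (real m) (Suc j + 1) * c j
        - pochhammer (real m) (j + 1) * (real (j + 1) * c j))"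
      by (intro sum.cong refl) (simp add: pochhammer_Suc algebra_simps)
    also have "\<dots> = (\<Sum>j\<le>k. pochhammer (real m) (Suc j + 1) * c j)
        - (\<Sum>j\<le>k. pochhammer (real m) (j + 1) * (real (j + 1) * c j))"
      by (rule sum_subtractf)
    also have "(\<Sum>j\<le>k. pochhammer (real m) (Suc j + 1) * c j) =
        (\<Sum>j\<le>Suc k. pochhammer (real m) (j + 1) * (if j = 0 then 0 else c (j - 1)))"
      by (subst sum.atMost_Suc_shift) simp
    also have "(\<Sum>j\<le>k. pochhammer (real m) (j + 1) * (real (j + 1) * c j)) =
        (\<Sum>j\<le>Suc k. pochhammer (real m) (j + 1) * (if j \<le> k then real (j + 1) * c j else 0))"
      by simp
    finally show ?thesis
      by (simp only: d_def right_diff_distrib sum_subtractf)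
  qed
  then show ?case by blast
qed

lemma perm_gen_mat_invertible: "invertible_mat (perm_gen_mat n)"
proof -
  let ?A = "perm_gen_mat n"
  have A: "?A \<in> carrier_mat n n" and gen: "\<And>m. mat_of_row (rising_row n m) = mat_of_row (power_row n m) * ?A"
    using is_perm_gen_mat_perm_gen_mat by (auto simp: is_perm_gen_mat_def)
  obtain c where c: "\<And>k m. real m ^ Suc k = (\<Sum>j\<le>k. pochhammer (real m) (j + 1) * c k j)"
    using power_eq_pochhammer_sum by metis
  define B where "B = mat n n (\<lambda>(j, i). if j + i < n then c (n - i - 1) j else 0)"
  have B: "B \<in> carrier_mat n n" by (simp add: B_def)
  have pr: "power_row n m \<in> carrier_vec n" and rr: "rising_row n m \<in> carrier_vec n" for m
    by (auto simp: power_row_def rising_row_def)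
  have "mat_of_row (power_row n m) = mat_of_row (rising_row n m) * B" for m
  proof (subst mat_of_row_mult_eq_iff[OF rr B pr], intro allI impI)
    fix i assume i: "i < n"
    have "real m ^ (n - i) = real m ^ Suc (n - i - 1)"
      using i by (intro arg_cong[of _ _ "\<lambda>e. real m ^ e"]) simp
    also have "\<dots> = (\<Sum>j\<le>n - i - 1. pochhammer (real m) (j + 1) * c (n - i - 1) j)" by (rule c)
    also have "\<dots> = (\<Sum>j<n. pochhammer (real m) (j + 1) * (if j + i < n then c (n - i - 1) j else 0))"
      using i by (intro sum.mono_neutral_cong_left) auto
    finally show "power_row n m $ i = (\<Sum>j<n. rising_row n m $ j * B $$ (j, i))"
      using i by (simp add: power_row_def rising_row_def B_def)
  qed
  then have "mat_of_row (power_row n m) = mat_of_row (power_row n m) * ?A * B" for m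
    unfolding gen[symmetric] .
  then have "mat_of_row (power_row n m) = mat_of_row (power_row n m) * (?A * B)" for m
    unfolding assoc_mult_mat[OF mat_of_row_carrier(1)[OF pr] A B] .
  then have "\<forall>j<n. power_row n m $ j = (\<Sum>i<n. power_row n m $ i * (?A * B) $$ (i, j))" for m
    using mat_of_row_mult_eq_iff[OF pr mult_carrier_mat[OF A B] pr] by blast
  then have AB: "real m ^ (n - j) = (\<Sum>i<n. real m ^ (n - i) * (?A * B) $$ (i, j))" if "j < n" for m j
    using that by (simp add: power_row_def)
  have "\<forall>i<n. (?A * B) $$ (i, j) = (if i = j then 1 else 0)" if "j < n" for j
    by (rule power_row_sum_eq_imp)
       (use AB[OF that] that in \<open>simp add: if_distrib cong: if_cong\<close>)
  then have 1: "?A * B = 1\<^sub>m n" using A B by (intro eq_matI) auto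
  then have "B * ?A = 1\<^sub>m n" using mat_mult_left_right_inverse[OF A B] by blast
  with 1 A B show ?thesis
    by (auto simp: invertible_mat_def inverts_mat_def)
qed

end

theory Submission
  imports Defs
begin

text \<open>
  The inverse of $A_n$ is the change of basis that expands the powers in rising factorials, so its
  columns are the coefficients of those expansions.  They are Stirling numbers of the second kind
  with alternating signs (lemma \<open>power_eq_sum_Stirling_pochhammer\<close>): column $j$ belongs to the
  power $x^{n+1-j}$, whence $b_{ij} = (-1)^{i+j+n+1} S(n+1-j, i)$ (lemma
  \<open>inverse_perm_gen_mat_entry\<close>).

  All four claims are then known properties of Stirling numbers.  The first two hold because $S$ is
  unitriangular, the third is $S(k+1,i) = i\,S(k,i) + S(k,i-1)$ with the signs put in, and the
  fourth is $S(k+1,1) = 1$.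
\<close>

text \<open>
  The identity comes from $x\,x^{(j)} = x^{(j+1)} - j\,x^{(j)}$, where $x^{(j)}$ is the rising
  factorial: multiplication by $x$ acts on the coefficients by the recurrence of the Stirling
  numbers, except for a minus sign at $j$, which the alternating signs absorb.
\<close>

lemma power_eq_sum_Stirling_pochhammer:
  fixes x :: "'a::comm_ring_1"
  shows "x ^ k = (\<Sum>j\<le>k. (-1) ^ (k + j) * of_nat (Stirling k j) * pochhammer x j)"
proof (induction k)
  case 0
  show ?case by simp
next
  case (Suc k)
  define c :: "nat \<Rightarrow> 'a" where "c j = (-1) ^ (k + j) * of_nat (Stirling k j)" for j
  have "x ^ Suc k = (\<Sum>j\<le>k. x * (c j * pochhammer x j))"
    by (simp add: Suc.IH c_def sum_distrib_left)
  also have "\<dots> = (\<Sum>j\<le>k. c j * pochhammer x (Suc j) - of_nat j * c j * pochhammer x j)"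
    by (intro sum.cong refl) (simp add: pochhammer_Suc algebra_simps)
  also have "\<dots> = (\<Sum>j\<le>k. c j * pochhammer x (Suc j)) - (\<Sum>j\<le>k. of_nat j * c j * pochhammer x j)"
    by (rule sum_subtractf)
  \<comment> \<open>The term at $0$ vanishes and so does the one at $k+1$, as $S(k,k+1) = 0$.\<close>
  also have "(\<Sum>j\<le>k. of_nat j * c j * pochhammer x j) =
      (\<Sum>j\<le>Suc k. of_nat j * c j * pochhammer x j)"
    by (simp add: c_def)
  also have "\<dots> = (\<Sum>j\<le>k. of_nat (Suc j) * c (Suc j) * pochhammer x (Suc j))"
    by (simp add: sum.atMost_Suc_shift del: sum.atMost_Suc)
  also have "(\<Sum>j\<le>k. c j * pochhammer x (Suc j)) - \<dots> =
      (\<Sum>j\<le>k. (-1) ^ (Suc k + Suc j) * of_nat (Stirling (Suc k) (Suc j)) * pochhammer x (Suc j))"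
    unfolding sum_subtractf[symmetric]
    by (intro sum.cong refl) (simp add: c_def algebra_simps)
  also have "\<dots> = (\<Sum>j\<le>Suc k. (-1) ^ (Suc k + j) * of_nat (Stirling (Suc k) j) * pochhammer x j)"
    by (simp add: sum.atMost_Suc_shift del: sum.atMost_Suc)
  finally show ?case .
qed

text \<open>
  Substituting the defining property of $A_n$ into the expansions of the powers shows that $A_n$
  times the claimed matrix fixes the row $(m^n, \<dots>, m)$ for every $m$.  Infinitely many $m$ leave
  only the identity, since a nonzero polynomial has finitely many roots; and a right inverse of
  $A_n$ equals any left inverse.
\<close>

lemma inverse_perm_gen_mat_entry:
  assumes B: "B \<in> carrier_mat n n" and inv: "inverts_mat B (perm_gen_mat n)"
    and ij: "i \<in> {1..n}" "j \<in> {1..n}"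
  shows "entry1 B i j = (-1) ^ (n + 1 - j + i) * real (Stirling (n + 1 - j) i)"
proof -
  let ?A = "perm_gen_mat n"
  define C where "C = mat n n (\<lambda>(i, j). (-1) ^ (n - j + Suc i) * real (Stirling (n - j) (Suc i)))"
  have C: "C \<in> carrier_mat n n" by (simp add: C_def)
  have A: "?A \<in> carrier_mat n n"
    and gen: "\<And>m k. k < n \<Longrightarrow>
      pochhammer (real m) (k + 1) = (\<Sum>i<n. real m ^ (n - i) * ?A $$ (i, k))"
    using is_perm_gen_mat_perm_gen_mat by (auto simp: is_perm_gen_mat_iff)
  have "(\<Sum>i<n. real m ^ (n - i) * (?A * C) $$ (i, l)) =
      (\<Sum>i<n. real m ^ (n - i) * 1\<^sub>m n $$ (i, l))" if l: "l < n" for m l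
  proof -
    have "(\<Sum>i<n. real m ^ (n - i) * (?A * C) $$ (i, l)) =
        (\<Sum>i<n. \<Sum>k<n. real m ^ (n - i) * ?A $$ (i, k) * C $$ (k, l))"
      using A C l
      by (intro sum.cong refl)
         (simp add: scalar_prod_def lessThan_atLeast0 sum_distrib_left mult.assoc)
    also have "\<dots> = (\<Sum>k<n. \<Sum>i<n. real m ^ (n - i) * ?A $$ (i, k) * C $$ (k, l))"
      by (rule sum.swap)
    also have "\<dots> = (\<Sum>k<n. C $$ (k, l) * pochhammer (real m) (Suc k))"
      using gen by (intro sum.cong refl) (simp add: sum_distrib_right[symmetric])
    also have "\<dots> = (\<Sum>k<n. (-1) ^ (n - l + Suc k) * real (Stirling (n - l) (Suc k)) *
        pochhammer (real m) (Suc k))"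
      using l by (intro sum.cong refl) (simp add: C_def)
    \<comment> \<open>The term at $0$ that the shift adds vanishes, because $n - l > 0$.\<close>
    also have "\<dots> = (\<Sum>k\<le>n. (-1) ^ (n - l + k) * real (Stirling (n - l) k) *
        pochhammer (real m) k)"
      using l by (subst sum.atMost_shift) (cases "n - l", auto)
    also have "\<dots> = (\<Sum>k\<le>n - l. (-1) ^ (n - l + k) * real (Stirling (n - l) k) *
        pochhammer (real m) k)"
      by (rule sum.mono_neutral_right) auto
    also have "\<dots> = real m ^ (n - l)"
      using power_eq_sum_Stirling_pochhammer[of "real m" "n - l"] by simp
    also have "\<dots> = (\<Sum>i<n. real m ^ (n - i) * 1\<^sub>m n $$ (i, l))"
      using l by (simp add: if_distrib cong: if_cong)
    finally show ?thesis .
  qed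
  then have "(?A * C) $$ (i, l) = 1\<^sub>m n $$ (i, l)" if "i < n" "l < n" for i l
    using power_row_sum_eq_imp[of n "\<lambda>i. (?A * C) $$ (i, l)" "\<lambda>i. 1\<^sub>m n $$ (i, l)"] that by blast
  then have AC: "?A * C = 1\<^sub>m n"
    using A C by (intro eq_matI) auto
  have BA: "B * ?A = 1\<^sub>m n"
    using inv B by (simp add: inverts_mat_def)
  have "B = B * (?A * C)" using B by (simp add: AC)
  also have "\<dots> = C" using assoc_mult_mat[OF B A C] C by (simp add: BA)
  finally have "B = C" .
  moreover have "i - 1 < n" "j - 1 < n" "n - (j - 1) = n + 1 - j" "Suc (i - 1) = i"
    using ij by auto
  ultimately show ?thesis
    by (simp only: entry1_def C_def index_mat prod.case)
qed

theorem theorem2p4: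
  fixes n :: nat and B :: "real mat"
  assumes "n \<ge> 1"
    and "B \<in> carrier_mat n n"
    and "inverts_mat (perm_gen_mat n) B" and "inverts_mat B (perm_gen_mat n)"
  shows "\<forall>i\<in>{1..n}. \<forall>j\<in>{1..n}.
      (i + j > n + 1 \<longrightarrow> entry1 B i j = 0) \<and>
      (i + j = n + 1 \<longrightarrow> entry1 B i j = 1) \<and>
      (i + j \<le> n \<and> i \<noteq> 1 \<longrightarrow>
         entry1 B i j = - real i * entry1 B i (j + 1) + entry1 B (i - 1) (j + 1)) \<and>
      (i = 1 \<longrightarrow> entry1 B 1 j = (-1) ^ (j + n))"
proof (intro ballI)
  fix i j assume i: "i \<in> {1..n}" and j: "j \<in> {1..n}"
  note entry = inverse_perm_gen_mat_entry[OF assms(2,4)]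
  define k where "k = n - j"
  have k: "n + 1 - j = Suc k" "n = k + j" using j by (auto simp: k_def)
  have e: "entry1 B i j = (-1) ^ (Suc k + i) * real (Stirling (Suc k) i)"
    using entry[OF i j] by (simp only: k(1))
  have "entry1 B i j = 0" if "i + j > n + 1"
    using that by (simp add: e k(2))
  moreover have "entry1 B i j = 1" if "i + j = n + 1"
  proof -
    have "i = Suc k" using that k(2) by simp
    then show ?thesis unfolding e by (simp add: power_add)
  qed
  moreover have "entry1 B i j = - real i * entry1 B i (j + 1) + entry1 B (i - 1) (j + 1)"
    if "i + j \<le> n" "i \<noteq> 1"
  proof -
    obtain h where h: "i = Suc h" "h \<in> {1..n}" using i \<open>i \<noteq> 1\<close> by (cases i) auto
    have j': "j + 1 \<in> {1..n}" and "n + 1 - (j + 1) = k"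
      using that i by (auto simp: k_def)
    then have "entry1 B i (j + 1) = (-1) ^ (k + i) * real (Stirling k i)"
      and "entry1 B (i - 1) (j + 1) = (-1) ^ (k + h) * real (Stirling k h)"
      using entry[OF i j'] entry[OF h(2) j'] h(1) by simp_all
    then show ?thesis unfolding e by (simp add: h(1) algebra_simps)
  qed
  moreover have "entry1 B 1 j = (-1) ^ (j + n)" if "i = 1"
  proof -
    have "Stirling (Suc k) i = 1" using that by (simp del: Stirling.simps)
    moreover have "j + n = k + 2 * j" using k(2) by simp
    ultimately show ?thesis using e that by (simp add: power_add power_mult del: Stirling.simps)
  qed
  ultimately show "(i + j > n + 1 \<longrightarrow> entry1 B i j = 0) \<and>
      (i + j = n + 1 \<longrightarrow> entry1 B i j = 1) \<and>
      (i + j \<le> n \<and> i \<noteq> 1 \<longrightarrow>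
         entry1 B i j = - real i * entry1 B i (j + 1) + entry1 B (i - 1) (j + 1)) \<and>
      (i = 1 \<longrightarrow> entry1 B 1 j = (-1) ^ (j + n))"
    by blast
qed

end
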